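(* Let $n\in\mathbb{N}$. For every projection matrix $P \in \mathbb{R}^{n\times n}$ with $P \neq 0$ there exists an open and dense set $\mathcal{M} \subseteq \mathbb{R}^{n\times n}$ such that the following holds: if $A \in \mathcal{M}$ and $A$ has an eigenvalue with positive real part, then there exist $T \geq 2$ and $u \in C([0,T],\mathbb{R}^n)$ with $W_T(u) < 0$. (In particular, the system $\dot x(t) = A x(t) + P u(t)$ is then locally active.)
   Context: A projection matrix is a matrix $P\in\mathbb{R}^{n\times n}$ with $P^2=P$ (not necessarily orthogonal). $\langle\cdot,\cdot\rangle$ is the standard inner product on $\mathbb{R}^n$. Eigenvalues of $A$ are complex eigenvalues. For $A, P \in \mathbb{R}^{n\times n}$ with $P$ a projection, $T>0$ and $u \in C([0,T],\mathbb{R}^n)$, let $x \in C([0,T],\mathbb{R}^n)$ be the solution of the initial value problem $\dot x(t) = Ax(t)+Pu(t)$, $x(0)=0$, and define $$W_T(u) := \int_0^T \langle x(t), P u(t)\rangle\, dt.$$ The equation $\dot x(t) = A x(t) + P u(t)$ is called locally active if there exist $T>0$ and $u \in C([0,T],\mathbb{R}^n)$ with $W_T(u)<0$. *)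

theory Defs
  imports "HOL-Analysis.Analysis"
begin

definition projection_matrix :: "real^'n^'n \<Rightarrow> bool" where
  "projection_matrix P \<longleftrightarrow> P ** P = P"

definition complex_eigenvalue :: "real^'n^'n \<Rightarrow> complex \<Rightarrow> bool" where
  "complex_eigenvalue A l \<longleftrightarrow> (\<exists>v. v \<noteq> 0 \<and> map_matrix complex_of_real A *v v = l *s v)"

definition is_ivp_solution ::
    "real^'n^'n \<Rightarrow> real^'n^'n \<Rightarrow> real \<Rightarrow> (real \<Rightarrow> real^'n) \<Rightarrow> (real \<Rightarrow> real^'n) \<Rightarrow> bool" where
  "is_ivp_solution A P T u x \<longleftrightarrow>
     x 0 = 0 \<and>
     (\<forall>t\<in>{0..T}. (x has_vector_derivative (A *v x t + P *v u t)) (at t within {0..T}))"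

(* For u continuous on {0..T} the solution exists and is unique on {0..T}; only its values
   outside {0..T}, which the integral below does not see, depend on the choice. *)
definition ivp_solution ::
    "real^'n^'n \<Rightarrow> real^'n^'n \<Rightarrow> real \<Rightarrow> (real \<Rightarrow> real^'n) \<Rightarrow> real \<Rightarrow> real^'n" where
  "ivp_solution A P T u = (SOME x. is_ivp_solution A P T u x)"

definition W :: "real^'n^'n \<Rightarrow> real^'n^'n \<Rightarrow> real \<Rightarrow> (real \<Rightarrow> real^'n) \<Rightarrow> real" where
  "W A P T u = integral {0..T} (\<lambda>t. ivp_solution A P T u t \<bullet> (P *v u t))"

definition locally_active :: "real^'n^'n \<Rightarrow> real^'n^'n \<Rightarrow> bool" where
  "locally_active A P \<longleftrightarrow> (\<exists>T>0. \<exists>u. continuous_on {0..T} u \<and> W A P T u < 0)"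

end

theory Submission
  imports Defs
begin

text \<open>
  Choose a nonzero vector \<open>p\<close> with \<open>P p = p\<close> and use only scalar controls \<open>u(t) = f(t) p\<close>. By variation of
  constants, \<open>W\<^sub>T(u)\<close> is then the integral of \<open>f(t) f(s) k(t - s)\<close> over \<open>0 \<le> s \<le> t \<le> T\<close>, where
  \<open>k(t) = \<langle>e\<^bsup>tA\<^esup> p, p\<rangle>\<close>. If such a form is nonnegative for all \<open>f\<close>, then \<open>k(|t - s|)\<close> is a positive
  definite kernel, hence \<open>|k(t)| \<le> k(0) = |p|\<^sup>2\<close>. Quantitatively, if \<open>|k(\<tau>)| > 5 |p|\<^sup>2\<close> for some \<open>\<tau> > 0\<close>,
  two narrow bumps at times \<open>0\<close> and \<open>\<tau>\<close> with suitable signs make \<open>W\<^sub>T(u)\<close> negative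
  (\<open>W_negative_of_large_impulse_response\<close>).

  The required set is \<open>L \<union> interior S\<close>, where \<open>L\<close> consists of the matrices with \<open>|k(\<tau>)| > 5 |p|\<^sup>2\<close> for
  some \<open>\<tau> > 0\<close>, and \<open>S\<close> of the matrices without eigenvalues of positive real part. It is open because
  \<open>e\<^bsup>\<tau>A\<^esup>\<close> depends continuously on \<open>A\<close>, and its members that lie outside \<open>S\<close> belong to \<open>L\<close>. For density
  it has to be shown that every unstable matrix \<open>A\<close> is a limit of members of \<open>L\<close>
  (\<open>large_impulse_response_near_unstable\<close>). Here \<open>A\<close> is perturbed by similarity only. Conjugating \<open>A\<close> with a
  matrix \<open>Q\<close> near the identity turns \<open>k\<close> into \<open>\<langle>e\<^bsup>tA\<^esup> Q\<^bsup>-1\<^esup> p, Q\<^bsup>T\<^esup> p\<rangle>\<close>. If all these functions were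
  bounded in \<open>t\<close>, then bilinearity would spread boundedness from the pairs \<open>(Q\<^bsup>-1\<^esup> p, Q\<^bsup>T\<^esup> p)\<close> to all
  pairs of vectors, because these pairs vary enough; but \<open>e\<^bsup>tA\<^esup>\<close> is unbounded along an eigenvector of an
  eigenvalue with positive real part (\<open>mexp_unbounded\<close>).
\<close>

section \<open>The matrix exponential\<close>

lemma bounded_bilinear_matrix_matrix_mult:
  "bounded_bilinear ((**) :: real^'n^'m \<Rightarrow> real^'k^'n \<Rightarrow> real^'k^'m)"
  unfolding bilinear_conv_bounded_bilinear[symmetric] bilinear_def
  by (auto intro!: linearI simp: matrix_matrix_mult_def
      vec_eq_iff sum.distrib distrib_left distrib_right sum_distrib_left mult_ac)

lemma bounded_bilinear_matrix_vector_mult: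
  "bounded_bilinear ((*v) :: real^'n^'m \<Rightarrow> real^'n \<Rightarrow> real^'m)"
  unfolding bilinear_conv_bounded_bilinear[symmetric] bilinear_def
  by (auto intro!: linearI simp: matrix_vector_mult_def
      vec_eq_iff sum.distrib distrib_left distrib_right sum_distrib_left mult_ac)

primrec matpow :: "real^'n^'n \<Rightarrow> nat \<Rightarrow> real^'n^'n" where
  "matpow A 0 = mat 1"
| "matpow A (Suc k) = A ** matpow A k"

lemma matpow_Suc_right: "matpow A (Suc k) = matpow A k ** A"
proof (induction k)
  case (Suc k)
  have "matpow A (Suc (Suc k)) = A ** (matpow A k ** A)"
    using Suc by (metis matpow.simps(2))
  then show ?case by (simp add: matrix_mul_assoc)
qed simp

lemma matpow_norm_bound:
  obtains K where "K > 0" and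
    "\<And>(A::real^'n^'n) k. norm (matpow A k) \<le> norm (mat 1 :: real^'n^'n) * (K * norm A) ^ k"
proof -
  obtain K where K: "K > 0" "\<And>(A::real^'n^'n) (B::real^'n^'n). norm (A ** B) \<le> norm A * norm B * K"
    using bounded_bilinear.pos_bounded[OF bounded_bilinear_matrix_matrix_mult] by blast
  have "norm (matpow A k) \<le> norm (mat 1 :: real^'n^'n) * (K * norm A) ^ k" for A :: "real^'n^'n" and k
  proof (induction k)
    case (Suc k)
    have "norm (matpow A (Suc k)) \<le> norm (matpow A k) * (K * norm A)"
      using K(2)[of A "matpow A k"] by (simp add: mult_ac)
    also have "\<dots> \<le> (norm (mat 1 :: real^'n^'n) * (K * norm A) ^ k) * (K * norm A)"
      using K(1) by (intro mult_right_mono Suc) auto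
    finally show ?case by (simp add: mult_ac)
  qed simp
  with K(1) show ?thesis using that by blast
qed

text \<open>The matrix exponential \<open>e\<^bsup>tA\<^esup>\<close>. Writing the series entrywise makes it a family of real power series in
  \<open>t\<close>, so that termwise differentiation is the classical one.\<close>
definition mexp :: "real^'n^'n \<Rightarrow> real \<Rightarrow> real^'n^'n" where
  "mexp A t = (\<chi> i j. \<Sum>k. (matpow A k $ i $ j / fact k) * t ^ k)"

text \<open>The majorant depends on \<open>A\<close> only through its norm. It gives both the convergence of the series and
  its uniform convergence for \<open>A\<close> in a ball, hence continuity in \<open>A\<close>.\<close>
lemma mexp_term_bound:
  obtains K C where "K > 0" "C \<ge> 0" and
    "\<And>(A::real^'n^'n) i j k t. \<bar>(matpow A k $ i $ j / fact k) * t ^ k\<bar> \<le> C * (inverse (fact k) * (K * norm A * \<bar>t\<bar>) ^ k)"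
proof -
  obtain K where K: "K > 0" "\<And>(A::real^'n^'n) k. norm (matpow A k) \<le> norm (mat 1 :: real^'n^'n) * (K * norm A) ^ k"
    using matpow_norm_bound by blast
  define C where "C = norm (mat 1 :: real^'n^'n)"
  have "\<bar>(matpow A k $ i $ j / fact k) * t ^ k\<bar> \<le> C * (inverse (fact k) * (K * norm A * \<bar>t\<bar>) ^ k)"
    for A :: "real^'n^'n" and i j k t
  proof -
    have "\<bar>matpow A k $ i $ j\<bar> \<le> norm (matpow A k)"
      by (metis Finite_Cartesian_Product.norm_nth_le order_trans real_norm_def)
    also have "\<dots> \<le> C * (K * norm A) ^ k" using K(2) C_def by auto
    finally have "\<bar>matpow A k $ i $ j\<bar> * (\<bar>t\<bar> ^ k / fact k) \<le> C * (K * norm A) ^ k * (\<bar>t\<bar> ^ k / fact k)"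
      by (intro mult_right_mono) auto
    then show ?thesis
      by (simp add: abs_mult power_abs power_mult_distrib divide_inverse mult_ac)
  qed
  then show ?thesis using that[of K C] K(1) C_def by auto
qed

lemma summable_mexp:
  "summable (\<lambda>k. (matpow (A::real^'n^'n) k $ i $ j / fact k) * t ^ k)"
proof -
  obtain K C where b: "\<And>(A::real^'n^'n) i j k t. \<bar>(matpow A k $ i $ j / fact k) * t ^ k\<bar> \<le> C * (inverse (fact k) * (K * norm A * \<bar>t\<bar>) ^ k)"
    using mexp_term_bound by metis
  show ?thesis
    by (rule summable_comparison_test'[where N=0 and g="\<lambda>k. C * (inverse (fact k) * (K * norm A * \<bar>t\<bar>) ^ k)"])
      (use b in \<open>auto intro!: summable_mult summable_exp simp del: times_divide_eq_left\<close>)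
qed

lemma mexp_0 [simp]: "mexp A 0 = mat 1"
  using powser_zero by (auto simp: mexp_def vec_eq_iff simp del: times_divide_eq_left)

lemma mexp_entry_has_derivative:
  "((\<lambda>t. mexp A t $ i $ j) has_real_derivative (\<Sum>k. (matpow A (Suc k) $ i $ j / fact k) * t ^ k)) (at t)"
proof -
  let ?c = "\<lambda>k. matpow A k $ i $ j / fact k"
  have "diffs ?c = (\<lambda>k. matpow A (Suc k) $ i $ j / fact k)"
    by (auto simp: diffs_def fun_eq_iff divide_simps simp del: matpow.simps)
  then show ?thesis
    using termdiffs_strong_converges_everywhere[of ?c t] summable_mexp[of A i j]
    by (simp add: mexp_def del: matpow.simps)
qed

lemma has_vector_derivative_matrix_entries:
  assumes "\<And>i j. ((\<lambda>t. F t $ i $ j) has_real_derivative F' $ i $ j) (at t within S)"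
  shows "(F has_vector_derivative (F' :: real^'n^'m)) (at t within S)"
  using assms
  by (subst has_vector_derivative_def, subst has_derivative_componentwise_within)
    (auto simp: Basis_vec_def inner_axis has_real_derivative_iff_has_vector_derivative
      has_vector_derivative_def)

text \<open>Splitting a factor \<open>A\<close> off the shifted powers on the left or on the right gives two forms of the
  derivative. With both at hand, the derivative of \<open>e\<^bsup>-tA\<^esup> x(t)\<close> can be simplified without a separate
  commutation law.\<close>
lemma mexp_has_vector_derivative_left:
  "(mexp A has_vector_derivative A ** mexp A t) (at t within S)"
proof (rule has_vector_derivative_matrix_entries)
  fix i j
  have "(\<Sum>k. (matpow A (Suc k) $ i $ j / fact k) * t ^ k)
      = (\<Sum>k. \<Sum>l\<in>UNIV. A $ i $ l * ((matpow A k $ l $ j / fact k) * t ^ k))"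
    by (simp add: matrix_matrix_mult_def sum_divide_distrib sum_distrib_left sum_distrib_right mult_ac)
  also have "\<dots> = (A ** mexp A t) $ i $ j"
    by (subst suminf_sum)
      (auto simp: matrix_matrix_mult_def mexp_def summable_mexp summable_mult suminf_mult
        simp del: times_divide_eq_left times_divide_eq_right)
  finally show "((\<lambda>t. mexp A t $ i $ j) has_real_derivative (A ** mexp A t) $ i $ j) (at t within S)"
    using mexp_entry_has_derivative[of A i j t] has_field_derivative_at_within by metis
qed

lemma mexp_has_vector_derivative_right:
  "(mexp A has_vector_derivative mexp A t ** A) (at t within S)"
proof (rule has_vector_derivative_matrix_entries)
  fix i j
  have "(\<Sum>k. (matpow A (Suc k) $ i $ j / fact k) * t ^ k)
      = (\<Sum>k. \<Sum>l\<in>UNIV. A $ l $ j * ((matpow A k $ i $ l / fact k) * t ^ k))"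
    unfolding matpow_Suc_right
    by (simp add: matrix_matrix_mult_def sum_divide_distrib sum_distrib_left sum_distrib_right mult_ac)
  also have "\<dots> = (\<Sum>l\<in>UNIV. A $ l $ j * mexp A t $ i $ l)"
    by (subst suminf_sum)
      (auto simp: mexp_def summable_mexp summable_mult suminf_mult
        simp del: times_divide_eq_left times_divide_eq_right)
  also have "\<dots> = (mexp A t ** A) $ i $ j"
    by (simp add: matrix_matrix_mult_def mult.commute)
  finally show "((\<lambda>t. mexp A t $ i $ j) has_real_derivative (mexp A t ** A) $ i $ j) (at t within S)"
    using mexp_entry_has_derivative[of A i j t] has_field_derivative_at_within by metis
qed

lemma continuous_on_matpow: "continuous_on S (\<lambda>A. matpow A k)"
  by (induction k) (auto intro!: continuous_intros
      bounded_bilinear.continuous_on[OF bounded_bilinear_matrix_matrix_mult])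

lemma continuous_on_mexp_generator: "continuous_on UNIV (\<lambda>A::real^'n^'n. mexp A t)"
proof -
  obtain K C where K: "K > 0" "C \<ge> 0" and b: "\<And>(A::real^'n^'n) i j k t. \<bar>(matpow A k $ i $ j / fact k) * t ^ k\<bar> \<le> C * (inverse (fact k) * (K * norm A * \<bar>t\<bar>) ^ k)"
    using mexp_term_bound by metis
  have "continuous_on (ball 0 r) (\<lambda>A::real^'n^'n. \<Sum>k. (matpow A k $ i $ j / fact k) * t ^ k)" for r i j
  proof (rule uniform_limit_theorem)
    show "uniform_limit (ball 0 r) (\<lambda>n A::real^'n^'n. \<Sum>k<n. (matpow A k $ i $ j / fact k) * t ^ k)
       (\<lambda>A. \<Sum>k. (matpow A k $ i $ j / fact k) * t ^ k) sequentially"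
    proof (rule Weierstrass_m_test)
      show "summable (\<lambda>k. C * (inverse (fact k) * (K * r * \<bar>t\<bar>) ^ k))"
        by (intro summable_mult summable_exp)
      fix k and A :: "real^'n^'n" assume "A \<in> ball 0 r"
      then have "norm A \<le> r" "0 \<le> r"
        using norm_ge_zero[of A] by (auto simp del: norm_ge_zero)
      then have "(K * norm A * \<bar>t\<bar>) ^ k \<le> (K * r * \<bar>t\<bar>) ^ k"
        using K by (intro power_mono mult_mono mult_nonneg_nonneg) auto
      then have "C * (inverse (fact k) * (K * norm A * \<bar>t\<bar>) ^ k) \<le> C * (inverse (fact k) * (K * r * \<bar>t\<bar>) ^ k)"
        using K by (intro mult_left_mono) auto
      then show "norm ((matpow A k $ i $ j / fact k) * t ^ k) \<le> C * (inverse (fact k) * (K * r * \<bar>t\<bar>) ^ k)"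
        using b[of A k i j t] by simp
    qed
  qed (auto intro!: continuous_intros continuous_on_matpow always_eventually)
  then have "continuous_on (ball 0 r) (\<lambda>A::real^'n^'n. mexp A t)" for r
    unfolding mexp_def by (intro continuous_on_vec_lambda)
  then show ?thesis
    by (metis continuous_on_eq_continuous_at open_ball mem_ball_0 less_add_one iso_tuple_UNIV_I open_UNIV)
qed

lemma mexp_uminus_has_vector_derivative:
  "((\<lambda>t. mexp A (- t)) has_vector_derivative - (mexp A (- t) ** A)) (at t within S)"
proof -
  have "(uminus has_vector_derivative (- 1 :: real)) (at t within S)"
    unfolding has_real_derivative_iff_has_vector_derivative[symmetric]
    by (auto intro!: derivative_eq_intros)
  from vector_diff_chain_within[OF this mexp_has_vector_derivative_right]
  show ?thesis by (simp add: o_def)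
qed

text \<open>The left side has derivative \<open>0\<close> in \<open>t\<close>, so it keeps its value at \<open>t = 0\<close>. Both the inverse
  \<open>e\<^bsup>-tA\<^esup>\<close> and the functional equation follow from this one identity.\<close>
lemma mexp_uminus_mult_mexp_add: "mexp A (- t) ** mexp A (t + s) = mexp A s"
proof -
  have "((\<lambda>t. mexp A (t + s)) has_vector_derivative A ** mexp A (t + s)) (at t)" for t
  proof -
    have "((\<lambda>t. t + s) has_vector_derivative 1) (at t)"
      unfolding has_real_derivative_iff_has_vector_derivative[symmetric]
      by (auto intro!: derivative_eq_intros)
    from vector_diff_chain_at[OF this mexp_has_vector_derivative_left]
    show ?thesis by (simp add: o_def)
  qed
  from bounded_bilinear.has_vector_derivative[OF bounded_bilinear_matrix_matrix_mult
      mexp_uminus_has_vector_derivative[where A = A] this]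
  have "((\<lambda>t. mexp A (- t) ** mexp A (t + s)) has_derivative (\<lambda>h. 0)) (at t)" for t
    by (simp add: matrix_mul_assoc has_vector_derivative_def
        bounded_bilinear.minus_left[OF bounded_bilinear_matrix_matrix_mult])
  then have "mexp A (- t) ** mexp A (t + s) = mexp A (- 0) ** mexp A (0 + s)"
    by (rule has_derivative_zero_unique[of UNIV, rotated]) auto
  then show ?thesis by simp
qed

lemma mexp_mult_mexp_uminus: "mexp A t ** mexp A (- t) = mat 1"
  using mexp_uminus_mult_mexp_add[of A "- t" 0] by simp

lemma mexp_add: "mexp A (t + s) = mexp A t ** mexp A s"
  by (metis matrix_mul_assoc matrix_mul_lid mexp_mult_mexp_uminus mexp_uminus_mult_mexp_add)

lemma continuous_on_mexp [continuous_intros]: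
  "continuous_on S f \<Longrightarrow> continuous_on S (\<lambda>t. mexp A (f t))"
  by (rule continuous_on_compose2[of UNIV "mexp A"])
    (auto intro!: continuous_at_imp_continuous_on has_vector_derivative_continuous
       mexp_has_vector_derivative_left)

lemmas continuous_on_matrix_vector_mult [continuous_intros] =
  bounded_bilinear.continuous_on[OF bounded_bilinear_matrix_vector_mult]

section \<open>Solutions of the initial value problem\<close>

text \<open>The integrating factor \<open>e\<^bsup>-tA\<^esup>\<close> turns the equation into \<open>(e\<^bsup>-tA\<^esup> x(t))' = e\<^bsup>-tA\<^esup> g(t)\<close>. The formula
  is stated for an arbitrary solution and therefore contains uniqueness.\<close>
lemma variation_of_constants:
  assumes g: "continuous_on {0..T} g" and t: "t \<in> {0..T}"
    and x: "\<And>t. t \<in> {0..T} \<Longrightarrow> (x has_vector_derivative A *v x t + g t) (at t within {0..T})"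
  shows "x t = mexp A t *v x 0 + integral {0..t} (\<lambda>s. mexp A (t - s) *v g s)"
proof -
  have "((\<lambda>t. mexp A (- t) *v x t) has_vector_derivative mexp A (- s) *v g s) (at s within {0..T})"
    if "s \<in> {0..T}" for s
    using bounded_bilinear.has_vector_derivative[OF bounded_bilinear_matrix_vector_mult
        mexp_uminus_has_vector_derivative x[OF that], of A]
    by (simp add: matrix_vector_right_distrib matrix_vector_mul_assoc
        bounded_bilinear.minus_left[OF bounded_bilinear_matrix_vector_mult])
  then have "((\<lambda>t. mexp A (- t) *v x t) has_vector_derivative mexp A (- s) *v g s) (at s within {0..t})"
    if "s \<in> {0..t}" for s
    by (rule has_vector_derivative_within_subset) (use that t in auto)
  then have I: "((\<lambda>s. mexp A (- s) *v g s) has_integral (mexp A (- t) *v x t - mexp A (- 0) *v x 0)) {0..t}"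
    using t by (intro fundamental_theorem_of_calculus) auto
  have "((\<lambda>s. mexp A t *v (mexp A (- s) *v g s)) has_integral
      mexp A t *v (mexp A (- t) *v x t - mexp A (- 0) *v x 0)) {0..t}"
    using has_integral_linear[OF I matrix_vector_mul_bounded_linear[of "mexp A t"]] by (simp add: o_def)
  then have "((\<lambda>s. mexp A (t - s) *v g s) has_integral (x t - mexp A t *v x 0)) {0..t}"
    by (simp add: matrix_vector_mul_assoc matrix_vector_mult_diff_distrib mexp_mult_mexp_uminus
        mexp_add[symmetric])
  then show ?thesis by (simp add: integral_unique)
qed

lemma mexp_unique:
  assumes "\<And>t. (x has_vector_derivative A *v x t) (at t)" and "t \<ge> 0"
  shows "x t = mexp A t *v x 0"
  using variation_of_constants[of t "\<lambda>_. 0" t x A] assms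
  by (auto intro: has_vector_derivative_at_within)

lemma is_ivp_solution_exists:
  assumes u: "continuous_on {0..T} u"
  shows "\<exists>x. is_ivp_solution A P T u x"
proof -
  let ?g = "\<lambda>s. mexp A (- s) *v (P *v u s)"
  let ?x = "\<lambda>t. mexp A t *v integral {0..t} ?g"
  have g: "continuous_on {0..T} ?g"
    by (intro continuous_intros u)
  have "(?x has_vector_derivative A *v ?x t + P *v u t) (at t within {0..T})" if "t \<in> {0..T}" for t
    using bounded_bilinear.has_vector_derivative[OF bounded_bilinear_matrix_vector_mult
        mexp_has_vector_derivative_left integral_has_vector_derivative[OF g that], of A]
    by (simp add: matrix_vector_mul_assoc mexp_mult_mexp_uminus matrix_mul_assoc add.commute)
  then have "is_ivp_solution A P T u ?x"
    by (auto simp: is_ivp_solution_def)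
  then show ?thesis by blast
qed

lemma is_ivp_solution_ivp_solution:
  "continuous_on {0..T} u \<Longrightarrow> is_ivp_solution A P T u (ivp_solution A P T u)"
  unfolding ivp_solution_def by (rule someI_ex[OF is_ivp_solution_exists])

lemma continuous_on_ivp_solution:
  assumes "continuous_on {0..T} u"
  shows "continuous_on {0..T} (ivp_solution A P T u)"
  using is_ivp_solution_ivp_solution[OF assms, of A P]
  by (auto simp: is_ivp_solution_def continuous_on_eq_continuous_within
      intro: has_vector_derivative_continuous)

lemma ivp_solution_eq:
  assumes u: "continuous_on {0..T} u" and t: "t \<in> {0..T}"
  shows "ivp_solution A P T u t = integral {0..t} (\<lambda>s. mexp A (t - s) *v (P *v u s))"
proof -
  have Pu: "continuous_on {0..T} (\<lambda>s. P *v u s)" by (intro continuous_intros u)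
  show ?thesis
    using variation_of_constants[OF Pu t, of "ivp_solution A P T u" A]
      is_ivp_solution_ivp_solution[OF u, of A P]
    by (auto simp: is_ivp_solution_def)
qed

text \<open>The impulse response at time \<open>t\<close> of the system \<open>x' = A x + f p\<close> with scalar input \<open>f\<close> and
  scalar output \<open>\<langle>x, p\<rangle>\<close>.\<close>
definition impulse_response :: "real^'n^'n \<Rightarrow> real^'n \<Rightarrow> real \<Rightarrow> real" where
  "impulse_response A p t = (mexp A t *v p) \<bullet> p"

lemma continuous_on_impulse_response [continuous_intros]:
  "continuous_on S f \<Longrightarrow> continuous_on S (\<lambda>t. impulse_response A p (f t))"
  unfolding impulse_response_def by (intro continuous_intros)

lemma ivp_solution_inner_scalar_control:
  assumes p: "P *v p = p" and f: "continuous_on {0..T} f" and t: "t \<in> {0..T}"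
  shows "ivp_solution A P T (\<lambda>t. f t *\<^sub>R p) t \<bullet> (P *v (f t *\<^sub>R p))
    = f t * integral {0..t} (\<lambda>s. f s * impulse_response A p (t - s))"
proof -
  have Pu: "P *v (f s *\<^sub>R p) = f s *\<^sub>R p" for s
    by (simp add: matrix_vector_mult_scaleR p)
  have c: "continuous_on {0..t} (\<lambda>s. mexp A (t - s) *v (f s *\<^sub>R p))"
    using t by (intro continuous_intros continuous_on_subset[OF f]) auto
  have "ivp_solution A P T (\<lambda>t. f t *\<^sub>R p) t \<bullet> p = integral {0..t} (\<lambda>s. mexp A (t - s) *v (f s *\<^sub>R p)) \<bullet> p"
    using t f by (subst ivp_solution_eq) (auto simp: Pu intro!: continuous_intros)
  also have "\<dots> = integral {0..t} (\<lambda>s. (mexp A (t - s) *v (f s *\<^sub>R p)) \<bullet> p)"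
    using integral_linear[OF integrable_continuous_real[OF c] bounded_linear_inner_left[of p]]
    by (simp add: o_def)
  finally show ?thesis
    unfolding Pu by (simp add: impulse_response_def matrix_vector_mult_scaleR)
qed

section \<open>A control with negative energy\<close>

lemma bump_function:
  fixes a b :: real
  assumes "a < b"
  obtains h :: "real \<Rightarrow> real" where "continuous_on UNIV h" "\<And>t. h t \<ge> 0" "\<And>t. t \<notin> {a..b} \<Longrightarrow> h t = 0"
    "\<And>S. {a..b} \<subseteq> S \<Longrightarrow> (h has_integral 1) S" "\<And>c d. integral {c..d} h \<le> 1"
proof -
  define g where "g t = max 0 ((t - a) * (b - t))" for t
  define c where "c = integral {a..b} g"
  have g: "continuous_on S g" for S
    unfolding g_def by (intro continuous_intros)
  have "g ((a + b) / 2) > 0"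
    using assms by (auto simp: g_def less_max_iff_disj intro!: mult_pos_pos)
  moreover have "(a + b) / 2 \<in> {a..b}" using assms by auto
  moreover have "g t \<ge> 0" for t by (simp add: g_def)
  ultimately have "c \<noteq> 0"
    using integral_eq_0_iff[OF g assms] unfolding c_def by (metis less_irrefl)
  moreover have "c \<ge> 0"
    unfolding c_def by (intro integral_nonneg integrable_continuous_real g) (auto simp: g_def)
  ultimately have c: "c > 0" by simp
  define h where "h t = g t / c" for t
  have h: "continuous_on S h" for S
    unfolding h_def using c by (intro continuous_intros g) auto
  have h0: "h t \<ge> 0" for t
    using c by (simp add: h_def g_def)
  have outside: "h t = 0" if "t \<notin> {a..b}" for t
  proof -
    have "(t - a) * (b - t) \<le> 0"
      using that assms by (auto simp: mult_le_0_iff)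
    then show ?thesis by (simp add: h_def g_def)
  qed
  have "(h has_integral 1) {a..b}"
  proof -
    have "((\<lambda>t. g t / c) has_integral c / c) {a..b}"
      unfolding c_def
      by (intro has_integral_divide integrable_integral integrable_continuous_real g)
    with c show ?thesis by (simp add: h_def[abs_def])
  qed
  then have I: "(h has_integral 1) S" if "{a..b} \<subseteq> S" for S
    using has_integral_on_superset that outside by blast
  have "integral {c..d} h \<le> integral UNIV h" for c d
    using I[of UNIV] h h0
    by (intro integral_subset_le integrable_continuous_real) auto
  then have le: "integral {c..d} h \<le> 1" for c d
    using I[of UNIV] by (simp add: integral_unique)
  show ?thesis by (rule that[of h]) (fact h h0 outside I le)+
qed

text \<open>Let \<open>\<phi>\<close> and \<open>\<psi>\<close> be bumps of mass one just after times \<open>0\<close> and \<open>\<tau>\<close>, and let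
  \<open>f = \<phi> - \<sigma> \<psi>\<close> with \<open>\<sigma>\<close> the sign of \<open>k(\<tau>)\<close>. If the bumps are narrow, then each bump interacts with itself
  through values of \<open>k\<close> near \<open>k(0) = |p|\<^sup>2\<close> and contributes at most \<open>2 |p|\<^sup>2\<close>, while the interaction between
  them contributes at most \<open>-5 |p|\<^sup>2\<close>. The total is at most \<open>-|p|\<^sup>2\<close>.\<close>
lemma W_negative_of_large_impulse_response:
  assumes p: "P *v p = p" "p \<noteq> 0" and "\<tau> > 0" and big: "5 * (p \<bullet> p) < \<bar>impulse_response A p \<tau>\<bar>"
  shows "\<exists>T\<ge>2. \<exists>u. continuous_on {0..T} u \<and> W A P T u < 0"
proof -
  define \<kappa> where "\<kappa> = p \<bullet> p"
  define \<sigma> where "\<sigma> = sgn (impulse_response A p \<tau>)"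
  have \<kappa>: "\<kappa> > 0" using p by (simp add: \<kappa>_def)
  have \<sigma>: "\<sigma> * \<sigma> = 1" "5 * \<kappa> < \<sigma> * impulse_response A p \<tau>"
    using big \<kappa> unfolding \<kappa>_def[symmetric] by (auto simp: \<sigma>_def sgn_if abs_if split: if_splits)
  have k: "isCont (impulse_response A p) t" for t
    using continuous_on_impulse_response[of UNIV "\<lambda>t. t" A p] by (simp add: continuous_on_eq_continuous_at)
  have "\<forall>\<^sub>F t in nhds 0. impulse_response A p t < 2 * \<kappa>"
    using k[of 0] \<kappa> unfolding continuous_at tendsto_at_iff_tendsto_nhds
    by (elim order_tendstoD) (auto simp: impulse_response_def \<kappa>_def)
  then obtain d1 where d1: "d1 > 0" "\<And>t. \<bar>t\<bar> < d1 \<Longrightarrow> impulse_response A p t < 2 * \<kappa>"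
    unfolding eventually_nhds_metric by (auto simp: dist_real_def)
  have "\<forall>\<^sub>F t in nhds \<tau>. 5 * \<kappa> < \<sigma> * impulse_response A p t"
    using k[of \<tau>] \<sigma> unfolding continuous_at tendsto_at_iff_tendsto_nhds
    by (intro order_tendstoD) (auto intro: tendsto_mult_left)
  then obtain d2 where d2: "d2 > 0" "\<And>t. \<bar>t - \<tau>\<bar> < d2 \<Longrightarrow> 5 * \<kappa> < \<sigma> * impulse_response A p t"
    unfolding eventually_nhds_metric by (auto simp: dist_real_def)
  define \<epsilon> where "\<epsilon> = min (min d1 d2) \<tau> / 2"
  have \<epsilon>: "\<epsilon> > 0" "\<epsilon> < d1" "\<epsilon> < d2" "\<epsilon> < \<tau>"
    using d1(1) d2(1) \<open>\<tau> > 0\<close> by (auto simp: \<epsilon>_def min_def)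
  obtain \<phi> :: "real \<Rightarrow> real" where \<phi>: "continuous_on UNIV \<phi>" "\<And>t. \<phi> t \<ge> 0" "\<And>t. t \<notin> {0..\<epsilon>} \<Longrightarrow> \<phi> t = 0"
    "\<And>S. {0..\<epsilon>} \<subseteq> S \<Longrightarrow> (\<phi> has_integral 1) S" "\<And>c d. integral {c..d} \<phi> \<le> 1"
    using bump_function[of 0 \<epsilon>] \<epsilon> by metis
  obtain \<psi> :: "real \<Rightarrow> real" where \<psi>: "continuous_on UNIV \<psi>" "\<And>t. \<psi> t \<ge> 0" "\<And>t. t \<notin> {\<tau>..\<tau>+\<epsilon>} \<Longrightarrow> \<psi> t = 0"
    "\<And>S. {\<tau>..\<tau>+\<epsilon>} \<subseteq> S \<Longrightarrow> (\<psi> has_integral 1) S" "\<And>c d. integral {c..d} \<psi> \<le> 1"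
    using bump_function[of \<tau> "\<tau>+\<epsilon>"] \<epsilon> by (metis less_add_same_cancel1)
  \<comment> \<open>After the second bump the control vanishes, so that extending the horizon to \<open>2\<close> costs
    nothing.\<close>
  define T where "T = max 2 (\<tau> + \<epsilon>)"
  define f where "f t = \<phi> t - \<sigma> * \<psi> t" for t
  have cont: "continuous_on S \<phi>" "continuous_on S \<psi>" "continuous_on S f" for S
    unfolding f_def using \<phi>(1) \<psi>(1) by (auto intro!: continuous_intros intro: continuous_on_subset)
  define g where "g t = integral {0..t} (\<lambda>s. f s * impulse_response A p (t - s))" for t
  \<comment> \<open>The control acts during at most one bump at a time. During the second bump the response \<open>g\<close>
    consists of the bump's own response and the echo of the first bump.\<close>
  have bound: "f t * g t \<le> 2 * \<kappa> * \<phi> t - 3 * \<kappa> * \<psi> t" if t: "t \<in> {0..T}" for t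
  proof -
    consider "t \<in> {0..\<epsilon>}" | "t \<in> {\<tau>..\<tau>+\<epsilon>}" | "t \<notin> {0..\<epsilon>}" "t \<notin> {\<tau>..\<tau>+\<epsilon>}" by blast
    then show ?thesis
    proof cases
      case 1
      have "g t \<le> integral {0..t} (\<lambda>s. 2 * \<kappa> * \<phi> s)"
        unfolding g_def
      proof (intro integral_le integrable_continuous_real continuous_intros cont)
        fix s assume s: "s \<in> {0..t}"
        have "\<psi> s = 0" using s 1 \<epsilon> by (intro \<psi>(3)) auto
        moreover have "impulse_response A p (t - s) \<le> 2 * \<kappa>"
          using s 1 \<epsilon> by (intro less_imp_le d1(2)) auto
        ultimately show "f s * impulse_response A p (t - s) \<le> 2 * \<kappa> * \<phi> s"
          using mult_left_mono[of "impulse_response A p (t - s)" "2 * \<kappa>" "\<phi> s"] \<phi>(2)[of s]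
          by (simp add: f_def mult.commute)
      qed
      also have "\<dots> \<le> 2 * \<kappa>"
        using \<phi>(5)[of 0 t] \<kappa> by simp
      finally have "\<phi> t * g t \<le> \<phi> t * (2 * \<kappa>)"
        by (intro mult_left_mono \<phi>(2))
      moreover have "\<psi> t = 0" using 1 \<epsilon> by (intro \<psi>(3)) auto
      ultimately show ?thesis by (simp add: f_def mult_ac)
    next
      case 2
      have "- \<sigma> * g t = integral {0..t} (\<lambda>s. - \<sigma> * (f s * impulse_response A p (t - s)))"
        by (simp add: g_def)
      also have "\<dots> \<le> integral {0..t} (\<lambda>s. - (5 * \<kappa>) * \<phi> s + 2 * \<kappa> * \<psi> s)"
      proof (intro integral_le integrable_continuous_real continuous_intros cont)
        fix s assume s: "s \<in> {0..t}"
        have "\<phi> s * (5 * \<kappa>) \<le> \<phi> s * (\<sigma> * impulse_response A p (t - s))"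
        proof (cases "s \<le> \<epsilon>")
          case True
          then show ?thesis using s 2 \<epsilon> by (intro mult_left_mono \<phi>(2) less_imp_le d2(2)) auto
        qed (use \<phi>(3) in auto)
        moreover have "\<psi> s * impulse_response A p (t - s) \<le> \<psi> s * (2 * \<kappa>)"
        proof (cases "s \<ge> \<tau>")
          case True
          then show ?thesis using s 2 \<epsilon> by (intro mult_left_mono \<psi>(2) less_imp_le d1(2)) auto
        qed (use \<psi>(3) in auto)
        moreover have "- \<sigma> * (f s * impulse_response A p (t - s))
            = \<sigma> * \<sigma> * (\<psi> s * impulse_response A p (t - s)) - \<phi> s * (\<sigma> * impulse_response A p (t - s))"
          by (simp add: f_def algebra_simps)
        ultimately show "- \<sigma> * (f s * impulse_response A p (t - s)) \<le> - (5 * \<kappa>) * \<phi> s + 2 * \<kappa> * \<psi> s"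
          by (simp add: \<sigma> mult_ac)
      qed
      also have "\<dots> = - (5 * \<kappa>) * integral {0..t} \<phi> + 2 * \<kappa> * integral {0..t} \<psi>"
        using cont by (subst integral_add) (auto intro!: integrable_continuous_real continuous_intros)
      also have "integral {0..t} \<phi> = 1"
        using 2 \<epsilon> by (intro integral_unique \<phi>(4)) auto
      also have "- (5 * \<kappa>) * 1 + 2 * \<kappa> * integral {0..t} \<psi> \<le> - (3 * \<kappa>)"
        using mult_left_mono[OF \<psi>(5)[of 0 t], of "2 * \<kappa>"] \<kappa> by simp
      finally have "\<psi> t * (- \<sigma> * g t) \<le> \<psi> t * (- (3 * \<kappa>))"
        by (intro mult_left_mono \<psi>(2))
      moreover have "\<phi> t = 0" using 2 \<epsilon> by (intro \<phi>(3)) auto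
      ultimately show ?thesis by (simp add: f_def mult_ac)
    next
      case 3
      then show ?thesis using \<phi>(3) \<psi>(3) by (simp add: f_def)
    qed
  qed
  let ?u = "\<lambda>t. f t *\<^sub>R p"
  have u: "continuous_on {0..T} ?u" by (intro continuous_intros cont)
  have "W A P T ?u \<le> integral {0..T} (\<lambda>t. 2 * \<kappa> * \<phi> t - 3 * \<kappa> * \<psi> t)"
    unfolding W_def
    using ivp_solution_inner_scalar_control[OF p(1) cont(3), of _ T A] bound
    by (intro integral_le integrable_continuous_real continuous_intros cont u continuous_on_ivp_solution)
      (auto simp: g_def)
  also have "\<dots> = 2 * \<kappa> * integral {0..T} \<phi> - 3 * \<kappa> * integral {0..T} \<psi>"
    using cont by (subst integral_diff) (auto intro!: integrable_continuous_real continuous_intros)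
  also have "integral {0..T} \<phi> = 1"
    using \<epsilon> by (intro integral_unique \<phi>(4)) (auto simp: T_def)
  also have "integral {0..T} \<psi> = 1"
    using \<epsilon> by (intro integral_unique \<psi>(4)) (auto simp: T_def)
  finally have "W A P T ?u < 0" using \<kappa> by simp
  with u show ?thesis by (intro exI[of _ T]) (auto simp: T_def)
qed

section \<open>Unstable matrices\<close>

text \<open>Let \<open>v = a + i b\<close> be a complex eigenvector. Then \<open>e\<^bsup>tA\<^esup> a\<close> and \<open>e\<^bsup>tA\<^esup> b\<close> are the real and imaginary
  parts of \<open>e\<^bsup>lt\<^esup> v\<close>. The squares of their \<open>j\<close>-th entries add up to
  \<open>e\<^bsup>2 Re l t\<^esup> |v\<^sub>j|\<^sup>2\<close>, so at least one of them is unbounded when \<open>v\<^sub>j \<noteq> 0\<close>.\<close>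
lemma mexp_unbounded:
  assumes "complex_eigenvalue A l" and "Re l > 0"
  shows "\<exists>x y. \<not> bounded ((\<lambda>t. (mexp A t *v x) \<bullet> y) ` {0<..})"
proof (rule ccontr)
  assume "\<not> ?thesis"
  then have bdd: "bounded ((\<lambda>t. (mexp A t *v x) \<bullet> y) ` {0<..})" for x y by blast
  obtain v where v: "v \<noteq> 0" "map_matrix complex_of_real A *v v = l *s v"
    using assms(1) by (auto simp: complex_eigenvalue_def)
  then obtain j where j: "v $ j \<noteq> 0" by (auto simp: vec_eq_iff)
  define \<alpha> \<beta> where "\<alpha> = Re l" "\<beta> = Im l"
  define a b where "a = (\<chi> i. Re (v $ i))" "b = (\<chi> i. Im (v $ i))"
  have eq: "(\<Sum>k\<in>UNIV. complex_of_real (A $ i $ k) * v $ k) = l * v $ i" for i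
    using v(2) by (auto simp: vec_eq_iff matrix_vector_mult_def map_matrix_def)
  have Aa: "A *v a = \<alpha> *\<^sub>R a - \<beta> *\<^sub>R b"
    using arg_cong[OF eq, of Re] by (auto simp: vec_eq_iff matrix_vector_mult_def a_b_def \<alpha>_\<beta>_def)
  have Ab: "A *v b = \<beta> *\<^sub>R a + \<alpha> *\<^sub>R b"
    using arg_cong[OF eq, of Im] by (auto simp: vec_eq_iff matrix_vector_mult_def a_b_def \<alpha>_\<beta>_def)
  let ?c = "\<lambda>t. exp (\<alpha> * t) *\<^sub>R (cos (\<beta> * t) *\<^sub>R a - sin (\<beta> * t) *\<^sub>R b)"
  let ?d = "\<lambda>t. exp (\<alpha> * t) *\<^sub>R (sin (\<beta> * t) *\<^sub>R a + cos (\<beta> * t) *\<^sub>R b)"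
  have "(?c has_vector_derivative A *v ?c t) (at t)" for t
    by (auto intro!: derivative_eq_intros simp: has_vector_derivative_def fun_eq_iff Aa Ab
        matrix_vector_mult_diff_distrib matrix_vector_mult_scaleR algebra_simps)
  then have c: "mexp A t *v a = ?c t" if "t \<ge> 0" for t
    using mexp_unique[of ?c A t] that by simp
  have "(?d has_vector_derivative A *v ?d t) (at t)" for t
    by (auto intro!: derivative_eq_intros simp: has_vector_derivative_def fun_eq_iff Aa Ab
        matrix_vector_right_distrib matrix_vector_mult_scaleR algebra_simps)
  then have d: "mexp A t *v b = ?d t" if "t \<ge> 0" for t
    using mexp_unique[of ?d A t] that by simp
  obtain C where C: "\<And>t. t > 0 \<Longrightarrow> \<bar>?c t $ j\<bar> \<le> C"
    using bdd[of a "axis j 1"] c by (auto simp: bounded_iff inner_axis)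
  obtain D where D: "\<And>t. t > 0 \<Longrightarrow> \<bar>?d t $ j\<bar> \<le> D"
    using bdd[of b "axis j 1"] d by (auto simp: bounded_iff inner_axis)
  have sq: "(?c t $ j)\<^sup>2 + (?d t $ j)\<^sup>2 = (exp (\<alpha> * t))\<^sup>2 * (cmod (v $ j))\<^sup>2" for t
  proof -
    have "(e * (c * x - s * y))\<^sup>2 + (e * (s * x + c * y))\<^sup>2 = e\<^sup>2 * ((s\<^sup>2 + c\<^sup>2) * (x\<^sup>2 + y\<^sup>2))"
      for e c s x y :: real
      by (simp add: power2_eq_square algebra_simps)
    from this[of "exp (\<alpha> * t)" "cos (\<beta> * t)" "a $ j" "sin (\<beta> * t)" "b $ j"]
    show ?thesis by (simp add: a_b_def cmod_power2)
  qed
  \<comment> \<open>At this time already the lower bound \<open>\<alpha> t\<close> for \<open>exp (2 \<alpha> t)\<close> contradicts the bounds \<open>C\<close> and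
    \<open>D\<close>.\<close>
  define t where "t = (C\<^sup>2 + D\<^sup>2 + 1) / (\<alpha> * (cmod (v $ j))\<^sup>2)"
  have pos: "\<alpha> > 0" "(cmod (v $ j))\<^sup>2 > 0" using assms(2) j by (auto simp: \<alpha>_\<beta>_def)
  then have "t > 0" unfolding t_def by (intro divide_pos_pos mult_pos_pos add_nonneg_pos) auto
  have "1 + \<alpha> * t \<le> exp (\<alpha> * t)" by (rule exp_ge_add_one_self)
  moreover have "exp (\<alpha> * t) \<ge> 1" using pos \<open>t > 0\<close> by simp
  then have "exp (\<alpha> * t) * 1 \<le> exp (\<alpha> * t) * exp (\<alpha> * t)"
    by (intro mult_left_mono) auto
  ultimately have "\<alpha> * t \<le> (exp (\<alpha> * t))\<^sup>2" unfolding power2_eq_square by linarith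
  then have "\<alpha> * t * (cmod (v $ j))\<^sup>2 \<le> (?c t $ j)\<^sup>2 + (?d t $ j)\<^sup>2"
    unfolding sq by (intro mult_right_mono) auto
  also have "\<dots> \<le> C\<^sup>2 + D\<^sup>2"
    by (intro add_mono) (use C[OF \<open>t > 0\<close>] D[OF \<open>t > 0\<close>] in \<open>simp_all add: abs_le_square_iff[symmetric]\<close>)
  finally show False using pos by (simp add: t_def)
qed

text \<open>Both sides solve the same linear initial value problem.\<close>
lemma mexp_conjugate:
  fixes A S S' :: "real^'n^'n"
  assumes S: "S ** S' = mat 1" and t: "t \<ge> 0"
  shows "mexp (S ** A ** S') t *v w = S *v (mexp A t *v (S' *v w))"
proof -
  let ?x = "\<lambda>t. S *v (mexp A t *v (S' *v w))"
  have S': "S' ** S = mat 1" using S matrix_left_right_inverse by blast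
  have "(?x has_vector_derivative (S ** A ** S') *v ?x t) (at t)" for t
  proof -
    have "((\<lambda>t. mexp A t *v (S' *v w)) has_vector_derivative (A ** mexp A t) *v (S' *v w)) (at t)"
      using bounded_linear.has_vector_derivative[OF bounded_bilinear.bounded_linear_left[OF
        bounded_bilinear_matrix_vector_mult] mexp_has_vector_derivative_left] .
    from bounded_linear.has_vector_derivative[OF matrix_vector_mul_bounded_linear[of S] this]
    show ?thesis
      by (simp add: matrix_vector_mul_assoc matrix_mul_assoc)
        (metis S' matrix_mul_assoc matrix_mul_rid)
  qed
  from mexp_unique[of ?x, OF this t] show ?thesis
    by (simp add: matrix_vector_mul_assoc S)
qed

definition outer :: "real^'n \<Rightarrow> real^'n \<Rightarrow> real^'n^'n" where
  "outer x y = (\<chi> i j. x $ i * y $ j)"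

lemma outer_mult_vec: "outer x y *v z = (y \<bullet> z) *\<^sub>R x"
  by (simp add: vec_eq_iff outer_def matrix_vector_mult_def inner_vec_def
      sum_distrib_left mult_ac)

text \<open>Suppose that the impulse response is bounded by \<open>c\<close> for all matrices in a neighbourhood \<open>B\<close> of \<open>A\<close>.
  Call a pair \<open>(q, r)\<close> bounded if \<open>\<langle>e\<^bsup>tA\<^esup> q, r\<rangle>\<close> is bounded for \<open>t > 0\<close>. For \<open>x\<close> and \<open>y\<close>
  orthogonal to \<open>p\<close> and small \<open>s > 0\<close>, the matrix \<open>Q = (1 + s x p\<^bsup>T\<^esup>) (1 + s p y\<^bsup>T\<^esup>)\<close> satisfies
  \<open>Q A Q\<^bsup>-1\<^esup> \<in> B\<close>, so the pair \<open>(Q\<^bsup>-1\<^esup> p, Q\<^bsup>T\<^esup> p)\<close> is bounded. Up to a multiple of \<open>p\<close> in the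
  first component, it is \<open>(p - s |p|\<^sup>2 x, p + s |p|\<^sup>2 y)\<close>. Taking \<open>x\<close> or \<open>y\<close> to be zero and using
  bilinearity, the pairs \<open>(p, p)\<close>, \<open>(x, p)\<close>, \<open>(p, y)\<close> and finally \<open>(x, y)\<close> are bounded. Decomposing along
  \<open>p\<close> and its orthogonal complement, every pair is bounded, which is impossible for unstable \<open>A\<close>.\<close>
lemma large_impulse_response_near_unstable:
  assumes B: "open B" "A \<in> B" and p: "p \<noteq> 0" and l: "complex_eigenvalue A l" "Re l > 0"
  shows "\<exists>A'\<in>B. \<exists>t>0. c < \<bar>impulse_response A' p t\<bar>"
proof (rule ccontr)
  assume "\<not> ?thesis"
  then have small: "\<bar>impulse_response A' p t\<bar> \<le> c" if "A' \<in> B" "t > 0" for A' t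
    using that by (meson not_less)
  define \<kappa> where "\<kappa> = p \<bullet> p"
  have \<kappa>: "\<kappa> > 0" using p by (simp add: \<kappa>_def)
  define bdd where "bdd q r \<longleftrightarrow> bounded ((\<lambda>t. (mexp A t *v q) \<bullet> r) ` {0<..})" for q r
  have claim: "\<exists>s>0. bdd (p - (\<kappa> * s) *\<^sub>R x + (\<kappa> * s\<^sup>2 * (x \<bullet> y)) *\<^sub>R p) (p + (\<kappa> * s) *\<^sub>R y)"
    if x: "x \<bullet> p = 0" and y: "y \<bullet> p = 0" for x y
  proof -
    \<comment> \<open>As \<open>x\<close> and \<open>y\<close> are orthogonal to \<open>p\<close>, both rank-one perturbations square to zero, so the
      inverse of each factor is obtained by changing a sign.\<close>
    let ?S = "\<lambda>s::real. (mat 1 + s *\<^sub>R outer x p) ** (mat 1 + s *\<^sub>R outer p y)"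
    let ?S' = "\<lambda>s::real. (mat 1 - s *\<^sub>R outer p y) ** (mat 1 - s *\<^sub>R outer x p)"
    have S: "?S s *v z = z + (s * (y \<bullet> z)) *\<^sub>R p + (s * (p \<bullet> z + s * (y \<bullet> z) * \<kappa>)) *\<^sub>R x" for s z
      by (simp add: matrix_vector_mul_assoc[symmetric] matrix_vector_mult_add_rdistrib
          scaleR_matrix_vector_assoc[symmetric] outer_mult_vec \<kappa>_def inner_add_right)
    have S': "?S' s *v z = z - (s * (p \<bullet> z)) *\<^sub>R x - (s * (y \<bullet> z - s * (p \<bullet> z) * (x \<bullet> y))) *\<^sub>R p" for s z
      by (simp add: matrix_vector_mul_assoc[symmetric] matrix_vector_mult_diff_rdistrib
          scaleR_matrix_vector_assoc[symmetric] outer_mult_vec inner_diff_right inner_commute)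
    have px: "p \<bullet> x = 0" and yx: "y \<bullet> x = x \<bullet> y"
      using x by (simp_all only: inner_commute)
    have inv: "?S s ** ?S' s = mat 1" for s
      unfolding matrix_eq
    proof
      fix z
      have 1: "y \<bullet> (?S' s *v z) = y \<bullet> z - s * (p \<bullet> z) * (x \<bullet> y)"
        unfolding S' inner_diff_right inner_scaleR_right y yx by simp
      have 2: "p \<bullet> (?S' s *v z) = p \<bullet> z - s * (y \<bullet> (?S' s *v z)) * \<kappa>"
        unfolding 1 unfolding S' inner_diff_right inner_scaleR_right px \<kappa>_def by simp
      have "?S s *v (?S' s *v z) = z"
        unfolding S 2 unfolding 1 unfolding S' by simp
      then show "?S s ** ?S' s *v z = mat 1 *v z"
        by (simp only: matrix_vector_mul_assoc matrix_vector_mul_lid)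
    qed
    have "continuous_on UNIV (\<lambda>s. ?S s ** A ** ?S' s)"
      by (intro continuous_intros
          bounded_bilinear.continuous_on[OF bounded_bilinear_matrix_matrix_mult])
    then have "((\<lambda>s. ?S s ** A ** ?S' s) \<longlongrightarrow> ?S 0 ** A ** ?S' 0) (at_right 0)"
      unfolding continuous_on_def by (blast intro: tendsto_within_subset)
    then have "\<forall>\<^sub>F s in at_right 0. ?S s ** A ** ?S' s \<in> B"
      by (rule topological_tendstoD) (use B in simp_all)
    then have "\<forall>\<^sub>F s in at_right 0. 0 < s \<and> ?S s ** A ** ?S' s \<in> B"
      by (intro eventually_conj eventually_at_right_less)
    from eventually_happens'[OF trivial_limit_at_right_real this]
    obtain s where s: "s > 0" "?S s ** A ** ?S' s \<in> B" by blast
    have "impulse_response (?S s ** A ** ?S' s) p t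
       = (mexp A t *v (p - (\<kappa> * s) *\<^sub>R x + (\<kappa> * s\<^sup>2 * (x \<bullet> y)) *\<^sub>R p)) \<bullet> (p + (\<kappa> * s) *\<^sub>R y)" if "t > 0" for t
    proof -
      have "?S' s *v p = p - (\<kappa> * s) *\<^sub>R x + (\<kappa> * s\<^sup>2 * (x \<bullet> y)) *\<^sub>R p"
        using y by (simp add: S' \<kappa>_def power2_eq_square mult_ac)
      moreover have "(?S s *v z) \<bullet> p = z \<bullet> (p + (\<kappa> * s) *\<^sub>R y)" for z
        using x by (simp add: S \<kappa>_def inner_add_left inner_add_right inner_commute)
      ultimately show ?thesis
        using that by (simp add: impulse_response_def mexp_conjugate[OF inv])
    qed
    with small[OF s(2)] have "bdd (p - (\<kappa> * s) *\<^sub>R x + (\<kappa> * s\<^sup>2 * (x \<bullet> y)) *\<^sub>R p) (p + (\<kappa> * s) *\<^sub>R y)"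
      unfolding bdd_def bounded_iff by auto
    with s(1) show ?thesis by blast
  qed
  have add_l: "bdd (q + q') r" if "bdd q r" "bdd q' r" for q q' r
    using bounded_plus_comp[OF that[unfolded bdd_def]]
    by (simp add: bdd_def matrix_vector_right_distrib inner_add_left)
  have add_r: "bdd q (r + r')" if "bdd q r" "bdd q r'" for q r r'
    using bounded_plus_comp[OF that[unfolded bdd_def]] by (simp add: bdd_def inner_add_right)
  have scale_l: "bdd (a *\<^sub>R q) r" if "bdd q r" for a q r
    using bounded_scaleR_comp[OF that[unfolded bdd_def], of a] by (simp add: bdd_def matrix_vector_mult_scaleR)
  have scale_r: "bdd q (a *\<^sub>R r)" if "bdd q r" for a q r
    using bounded_scaleR_comp[OF that[unfolded bdd_def], of a] by (simp add: bdd_def)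
  have cancel_l: "bdd q r" if "bdd (q' + a *\<^sub>R q) r" "bdd q' r" "a \<noteq> 0" for a q q' r
    using scale_l[OF add_l[OF that(1) scale_l[OF that(2), of "-1"]], of "1 / a"] that(3) by simp
  have cancel_r: "bdd q r" if "bdd q (r' + a *\<^sub>R r)" "bdd q r'" "a \<noteq> 0" for a q r r'
    using scale_r[OF add_r[OF that(1) scale_r[OF that(2), of "-1"]], of "1 / a"] that(3) by simp
  have pp: "bdd p p"
    using claim[of 0 0] by simp
  have xp: "bdd x p" if x: "x \<bullet> p = 0" for x
  proof -
    obtain s where s: "s > 0" "bdd (p + (- (\<kappa> * s)) *\<^sub>R x) p" using claim[of x 0] x by auto
    show ?thesis using cancel_l[OF s(2) pp] s(1) \<kappa> by simp
  qed
  have py: "bdd p y" if y: "y \<bullet> p = 0" for y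
  proof -
    obtain s where s: "s > 0" "bdd p (p + (\<kappa> * s) *\<^sub>R y)" using claim[of 0 y] y by auto
    show ?thesis using cancel_r[OF s(2) pp] s(1) \<kappa> by simp
  qed
  have xy: "bdd x y" if x: "x \<bullet> p = 0" and y: "y \<bullet> p = 0" for x y
  proof -
    obtain s where s: "s > 0"
      "bdd (p - (\<kappa> * s) *\<^sub>R x + (\<kappa> * s\<^sup>2 * (x \<bullet> y)) *\<^sub>R p) (p + (\<kappa> * s) *\<^sub>R y)"
      using claim[OF x y] by blast
    define a where "a = 1 + \<kappa> * s\<^sup>2 * (x \<bullet> y)"
    have "p - (\<kappa> * s) *\<^sub>R x + (\<kappa> * s\<^sup>2 * (x \<bullet> y)) *\<^sub>R p = a *\<^sub>R p + (- (\<kappa> * s)) *\<^sub>R x"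
      by (simp add: a_def scaleR_add_left)
    with s(2) have q: "bdd (a *\<^sub>R p + (- (\<kappa> * s)) *\<^sub>R x) (p + (\<kappa> * s) *\<^sub>R y)" by simp
    have "bdd (a *\<^sub>R p + (- (\<kappa> * s)) *\<^sub>R x) y"
      using cancel_r[OF q add_l[OF scale_l[OF pp] scale_l[OF xp[OF x]]]] s(1) \<kappa> by simp
    from cancel_l[OF this scale_l[OF py[OF y]]] show ?thesis using s(1) \<kappa> by simp
  qed
  have "bdd q r" for q r
  proof -
    have decomp: "\<exists>a z. q = a *\<^sub>R p + z \<and> z \<bullet> p = 0" for q
      by (rule exI[of _ "(q \<bullet> p) / \<kappa>"], rule exI[of _ "q - ((q \<bullet> p) / \<kappa>) *\<^sub>R p"])
        (use \<kappa> in \<open>simp add: inner_diff_left \<kappa>_def\<close>)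
    obtain a x b y where qr: "q = a *\<^sub>R p + x" "x \<bullet> p = 0" "r = b *\<^sub>R p + y" "y \<bullet> p = 0"
      using decomp[of q] decomp[of r] by blast
    have "bdd (a *\<^sub>R p + x) (b *\<^sub>R p + y)"
      by (rule add_l[OF scale_l[OF add_r[OF scale_r]] add_r[OF scale_r]])
        (fact pp py[OF qr(4)] xp[OF qr(2)] xy[OF qr(2,4)])+
    then show ?thesis by (simp only: qr(1,3))
  qed
  then show False
    using mexp_unbounded[OF l] by (auto simp: bdd_def)
qed

theorem theorem7:
  fixes P :: "real^'n^'n"
  assumes "projection_matrix P" and "P \<noteq> 0"
  shows "\<exists>M :: (real^'n^'n) set. open M \<and> closure M = UNIV \<and>
           (\<forall>A\<in>M. (\<exists>l. complex_eigenvalue A l \<and> Re l > 0) \<longrightarrow>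
              (\<exists>T\<ge>2. \<exists>u. continuous_on {0..T} u \<and> W A P T u < 0) \<and> locally_active A P)"
proof -
  have "\<exists>q. P *v q \<noteq> 0"
    using assms(2) matrix_eq[of P 0] by auto
  then obtain q where q: "P *v q \<noteq> 0" by blast
  define p where "p = P *v q"
  have p: "P *v p = p" "p \<noteq> 0"
    using assms(1) q by (simp_all add: p_def projection_matrix_def matrix_vector_mul_assoc)
  define L where "L = {A :: real^'n^'n. \<exists>t>0. 5 * (p \<bullet> p) < \<bar>impulse_response A p t\<bar>}"
  define S where "S = {A :: real^'n^'n. \<forall>l. complex_eigenvalue A l \<longrightarrow> Re l \<le> 0}"
  define M where "M = L \<union> interior S"
  have "open {A :: real^'n^'n. 5 * (p \<bullet> p) < \<bar>impulse_response A p t\<bar>}" for t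
    unfolding impulse_response_def
    by (intro open_Collect_less continuous_intros continuous_on_mexp_generator)
  then have "open (\<Union>t\<in>{0<..}. {A :: real^'n^'n. 5 * (p \<bullet> p) < \<bar>impulse_response A p t\<bar>})" by blast
  also have "(\<Union>t\<in>{0<..}. {A :: real^'n^'n. 5 * (p \<bullet> p) < \<bar>impulse_response A p t\<bar>}) = L"
    by (auto simp: L_def)
  finally have "open M" by (simp add: M_def open_Un)
  moreover have "closure M = UNIV"
  proof (rule ccontr)
    assume ne: "closure M \<noteq> UNIV"
    have U: "open (- closure M)" by (rule open_Compl[OF closed_closure])
    have "\<not> - closure M \<subseteq> S"
    proof
      assume "- closure M \<subseteq> S"
      then have "- closure M \<subseteq> interior S" using U by (rule interior_maximal)
      also have "\<dots> \<subseteq> closure M" using closure_subset by (auto simp: M_def)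
      finally show False using ne by auto
    qed
    then obtain A where A: "A \<in> - closure M" "A \<notin> S" by blast
    from A(2) obtain l where "complex_eigenvalue A l" "Re l > 0"
      by (auto simp: S_def not_le)
    with A(1) large_impulse_response_near_unstable[OF U _ p(2)] obtain A' where "A' \<in> - closure M" "A' \<in> L"
      unfolding L_def by blast
    then show False using closure_subset[of M] by (auto simp: M_def)
  qed
  moreover have "(\<exists>T\<ge>2. \<exists>u. continuous_on {0..T} u \<and> W A P T u < 0) \<and> locally_active A P"
    if A: "A \<in> M" and l: "complex_eigenvalue A l" "Re l > 0" for A l
  proof -
    have "A \<notin> S" using l by (auto simp: S_def not_le)
    then have "A \<in> L" using A interior_subset by (auto simp: M_def)
    then have *: "\<exists>T\<ge>2. \<exists>u. continuous_on {0..T} u \<and> W A P T u < 0"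
      using W_negative_of_large_impulse_response[OF p] by (auto simp: L_def)
    then obtain T u where "T \<ge> 2" "continuous_on {0..T} u" "W A P T u < 0" by blast
    then have "locally_active A P"
      unfolding locally_active_def by (intro exI[of _ T] conjI exI[of _ u]) auto
    with * show ?thesis by blast
  qed
  ultimately show ?thesis by blast
qed

end
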